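(* Let $\phi^t$ be a discrete or continuous-time flow on a compact metric space $(X,d)$, and let $M\subset X$ be an isolated compact $\phi^t$-invariant set which is not a repeller. Let $(\overline X,\overline d)$ be a metric space and let $\psi:X\to\overline X$ be a bi-Lipschitz bijection. Put $\overline\phi^t=\psi\phi^t\psi^{-1}$ and $\overline M=\psi(M)$. If $x\in\mathrm{st}(M)$ is metric regular and $\overline x=\psi(x)$, then $\overline x$ is metric regular for $\overline\phi^t$ relative to $\overline M$ and $$\lambda(\phi^t,x)=\lambda(\overline\phi^t,\overline x),$$ and moreover $$\Lambda(\phi^t,M)=\Lambda(\overline\phi^t,\overline M).$$ In particular, $\Lambda(\phi^t,M)$ is unchanged when $d$ is replaced by an equivalent metric on $X$ (two metrics being equivalent when the identity map between them is bi-Lipschitz).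
   Context: A map $\psi$ is bi-Lipschitz if there are constants $b,c>0$ with $b\,d(x,y)\le\overline d(\psi(x),\psi(y))\le c\,d(x,y)$ for all $x,y\in X$. For a flow $\phi^t$ ($t\in\mathbb R$ or $t\in\mathbb Z$) on a compact metric space $(X,d)$ and an isolated compact $\phi^t$-invariant set $M\subset X$, the stable set is $\mathrm{st}(M)=\{x\in X:\omega(x)\subset M\}$, where $\omega(x)$ is the omega-limit set. "$M$ is not a repeller" means that $\mathrm{st}(M)$ contains points outside $M$. A point $x\in\mathrm{st}(M)$ is metric regular (relative to $M$) if the (real) limit $$\lambda(\phi^t,x)=\lim_{t\to\infty}\frac1t\log d(\phi^t(x),M)$$ exists; it is called the metric exponent of $\phi^t$ starting at $x$. The metric spectrum of $\phi^t$ relative to $M$ is $\Lambda(\phi^t,M)=\{\lambda(\phi^t,x):x\in\mathrm{st}(M)\text{ metric regular}\}$. For $(\overline\phi^t,\overline M)$ the same notions are taken with respect to $\overline d$. *)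

theory Defs
  imports "HOL-Analysis.Analysis"
begin

text \<open>
  Metric spaces are elements of the library type \<open>'a metric\<close>, so that one set can carry several
  metrics. Both kinds of time are handled by a time set \<open>T\<close> of reals: \<open>UNIV\<close> for continuous time
  and \<open>\<int>\<close> for discrete time; \<open>\<phi> t\<close> is irrelevant for \<open>t\<close> outside \<open>T\<close>.
\<close>

definition flow_on :: "real set \<Rightarrow> 'a metric \<Rightarrow> (real \<Rightarrow> 'a \<Rightarrow> 'a) \<Rightarrow> bool" where
  "flow_on T m \<phi> \<longleftrightarrow>
     (T = UNIV \<or> T = \<int>) \<and>
     continuous_map (prod_topology (top_of_set T) (mtopology_of m)) (mtopology_of m)
       (\<lambda>(t, x). \<phi> t x) \<and>
     (\<forall>x\<in>mspace m. \<phi> 0 x = x) \<and>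
     (\<forall>s\<in>T. \<forall>t\<in>T. \<forall>x\<in>mspace m. \<phi> (s + t) x = \<phi> s (\<phi> t x))"

definition flow_invariant :: "real set \<Rightarrow> (real \<Rightarrow> 'a \<Rightarrow> 'a) \<Rightarrow> 'a set \<Rightarrow> bool" where
  "flow_invariant T \<phi> M \<longleftrightarrow> (\<forall>t\<in>T. \<phi> t ` M = M)"

definition isolated_invariant ::
    "real set \<Rightarrow> 'a metric \<Rightarrow> (real \<Rightarrow> 'a \<Rightarrow> 'a) \<Rightarrow> 'a set \<Rightarrow> bool" where
  "isolated_invariant T m \<phi> M \<longleftrightarrow>
     flow_invariant T \<phi> M \<and>
     (\<exists>U. openin (mtopology_of m) U \<and> M \<subseteq> U \<and>
        (\<forall>x\<in>mspace m. (\<forall>t\<in>T. \<phi> t x \<in> U) \<longrightarrow> x \<in> M))"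

definition omega_limit ::
    "real set \<Rightarrow> 'a metric \<Rightarrow> (real \<Rightarrow> 'a \<Rightarrow> 'a) \<Rightarrow> 'a \<Rightarrow> 'a set" where
  "omega_limit T m \<phi> x =
     {y. \<exists>\<tau> :: nat \<Rightarrow> real. range \<tau> \<subseteq> T \<and> filterlim \<tau> at_top sequentially \<and>
           limitin (mtopology_of m) (\<lambda>n. \<phi> (\<tau> n) x) y sequentially}"

definition stable_set ::
    "real set \<Rightarrow> 'a metric \<Rightarrow> (real \<Rightarrow> 'a \<Rightarrow> 'a) \<Rightarrow> 'a set \<Rightarrow> 'a set" where
  "stable_set T m \<phi> M = {x \<in> mspace m. omega_limit T m \<phi> x \<subseteq> M}"

definition is_repeller ::
    "real set \<Rightarrow> 'a metric \<Rightarrow> (real \<Rightarrow> 'a \<Rightarrow> 'a) \<Rightarrow> 'a set \<Rightarrow> bool" where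
  "is_repeller T m \<phi> M \<longleftrightarrow> stable_set T m \<phi> M \<subseteq> M"

definition dist_to_set :: "'a metric \<Rightarrow> 'a \<Rightarrow> 'a set \<Rightarrow> real" where
  "dist_to_set m x A = (INF a\<in>A. mdist m x a)"

definition time_at_top :: "real set \<Rightarrow> real filter" where
  "time_at_top T = inf at_top (principal T)"

definition log_rate ::
    "real set \<Rightarrow> 'a metric \<Rightarrow> (real \<Rightarrow> 'a \<Rightarrow> 'a) \<Rightarrow> 'a set \<Rightarrow> 'a \<Rightarrow> real \<Rightarrow> real" where
  "log_rate T m \<phi> M x t = 1 / t * ln (dist_to_set m (\<phi> t x) M)"

text \<open>
  Since \<open>log 0 = -\<infinity>\<close>, a real limit can exist only if the distance to \<open>M\<close> is eventually positive.
  This must be required separately because the library has \<open>ln 0 = 0\<close>; in particular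
  points of \<open>M\<close> are not metric regular.
\<close>
definition metric_regular ::
    "real set \<Rightarrow> 'a metric \<Rightarrow> (real \<Rightarrow> 'a \<Rightarrow> 'a) \<Rightarrow> 'a set \<Rightarrow> 'a \<Rightarrow> bool" where
  "metric_regular T m \<phi> M x \<longleftrightarrow>
     x \<in> stable_set T m \<phi> M \<and>
     (\<forall>\<^sub>F t in time_at_top T. 0 < dist_to_set m (\<phi> t x) M) \<and>
     (\<exists>l. (log_rate T m \<phi> M x \<longlongrightarrow> l) (time_at_top T))"

definition metric_exponent ::
    "real set \<Rightarrow> 'a metric \<Rightarrow> (real \<Rightarrow> 'a \<Rightarrow> 'a) \<Rightarrow> 'a set \<Rightarrow> 'a \<Rightarrow> real" where
  "metric_exponent T m \<phi> M x = Lim (time_at_top T) (log_rate T m \<phi> M x)"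

definition metric_spectrum ::
    "real set \<Rightarrow> 'a metric \<Rightarrow> (real \<Rightarrow> 'a \<Rightarrow> 'a) \<Rightarrow> 'a set \<Rightarrow> real set" where
  "metric_spectrum T m \<phi> M = {metric_exponent T m \<phi> M x | x. metric_regular T m \<phi> M x}"

definition bi_lipschitz :: "'a metric \<Rightarrow> 'b metric \<Rightarrow> ('a \<Rightarrow> 'b) \<Rightarrow> bool" where
  "bi_lipschitz m m' \<psi> \<longleftrightarrow>
     \<psi> \<in> mspace m \<rightarrow> mspace m' \<and>
     (\<exists>b>0. \<exists>c>0. \<forall>x\<in>mspace m. \<forall>y\<in>mspace m.
        b * mdist m x y \<le> mdist m' (\<psi> x) (\<psi> y) \<and>
        mdist m' (\<psi> x) (\<psi> y) \<le> c * mdist m x y)"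

definition equivalent_metrics :: "'a metric \<Rightarrow> 'a metric \<Rightarrow> bool" where
  "equivalent_metrics m m' \<longleftrightarrow> mspace m' = mspace m \<and> bi_lipschitz m m' id"

definition conjugate_flow ::
    "'a metric \<Rightarrow> ('a \<Rightarrow> 'b) \<Rightarrow> (real \<Rightarrow> 'a \<Rightarrow> 'a) \<Rightarrow> real \<Rightarrow> 'b \<Rightarrow> 'b" where
  "conjugate_flow m \<psi> \<phi> t = \<psi> \<circ> \<phi> t \<circ> inv_into (mspace m) \<psi>"

end

theory Submission
  imports Defs
begin

text \<open>
  A bi-Lipschitz map changes the distance to \<open>M\<close> along an orbit at most by a bounded factor, hence
  its logarithm by a bounded amount, which disappears after division by \<open>t\<close>. The inverse map is
  bi-Lipschitz too, so the spectra are included in each other; the change of metric is the case of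
  the identity map.
\<close>

section \<open>Bi-Lipschitz maps and their inverses\<close>

lemma bi_lipschitzE:
  assumes "bi_lipschitz m m' \<psi>"
  obtains b c where "b > 0" "c > 0"
    "\<And>x y. x \<in> mspace m \<Longrightarrow> y \<in> mspace m \<Longrightarrow> b * mdist m x y \<le> mdist m' (\<psi> x) (\<psi> y)"
    "\<And>x y. x \<in> mspace m \<Longrightarrow> y \<in> mspace m \<Longrightarrow> mdist m' (\<psi> x) (\<psi> y) \<le> c * mdist m x y"
  using assms unfolding bi_lipschitz_def by blast

text \<open>Apply the two inequalities to the preimages of \<open>x\<close> and \<open>y\<close> and
  solve for their distance: the constants \<open>b\<close> and \<open>c\<close> turn into
  \<open>1 / c\<close> and \<open>1 / b\<close>, the upper bound giving the new lower one and
  conversely.\<close>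

lemma bi_lipschitz_inv_into:
  assumes "bi_lipschitz m m' \<psi>" and bij: "bij_betw \<psi> (mspace m) (mspace m')"
  shows "bi_lipschitz m' m (inv_into (mspace m) \<psi>)"
proof -
  let ?g = "inv_into (mspace m) \<psi>"
  obtain b c where bc: "b > 0" "c > 0"
    and lower: "\<And>x y. x \<in> mspace m \<Longrightarrow> y \<in> mspace m \<Longrightarrow> b * mdist m x y \<le> mdist m' (\<psi> x) (\<psi> y)"
    and upper: "\<And>x y. x \<in> mspace m \<Longrightarrow> y \<in> mspace m \<Longrightarrow> mdist m' (\<psi> x) (\<psi> y) \<le> c * mdist m x y"
    using assms(1) by (rule bi_lipschitzE) blast
  have g: "?g x \<in> mspace m" "\<psi> (?g x) = x" if "x \<in> mspace m'" for x
    using that bij_betwE[OF bij_betw_inv_into[OF bij]] bij_betw_inv_into_right[OF bij] by auto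
  have "1 / c * mdist m' x y \<le> mdist m (?g x) (?g y) \<and>
        mdist m (?g x) (?g y) \<le> 1 / b * mdist m' x y"
    if "x \<in> mspace m'" "y \<in> mspace m'" for x y
    using lower[of "?g x" "?g y"] upper[of "?g x" "?g y"] g that bc by (simp add: field_simps)
  moreover have "1 / c > 0" "1 / b > 0"
    using bc by auto
  ultimately show ?thesis
    unfolding bi_lipschitz_def using g(1) by blast
qed

section \<open>Distance to a set under a bi-Lipschitz map\<close>

lemma dist_to_set_empty: "dist_to_set m x {} = dist_to_set m' y {}"
  by (simp add: dist_to_set_def)

lemma dist_to_set_le: "a \<in> A \<Longrightarrow> dist_to_set m x A \<le> mdist m x a"
  unfolding dist_to_set_def by (rule cINF_lower) (auto intro: bdd_belowI[where m = 0])

lemma dist_to_set_greatest: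
  "A \<noteq> {} \<Longrightarrow> (\<And>a. a \<in> A \<Longrightarrow> r \<le> mdist m x a) \<Longrightarrow> r \<le> dist_to_set m x A"
  unfolding dist_to_set_def by (rule cINF_greatest)

lemma dist_to_set_image_lower:
  assumes "M \<noteq> {}" "b > 0"
    and lower: "\<And>y. y \<in> M \<Longrightarrow> b * mdist m x y \<le> mdist m' (\<psi> x) (\<psi> y)"
  shows "b * dist_to_set m x M \<le> dist_to_set m' (\<psi> x) (\<psi> ` M)"
proof (rule dist_to_set_greatest)
  fix a assume "a \<in> \<psi> ` M"
  then obtain y where y: "y \<in> M" "a = \<psi> y" by blast
  have "b * dist_to_set m x M \<le> b * mdist m x y"
    using dist_to_set_le[OF y(1)] \<open>b > 0\<close> by simp
  with lower[OF y(1)] y(2) show "b * dist_to_set m x M \<le> mdist m' (\<psi> x) a" by simp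
qed (use assms in simp)

lemma dist_to_set_image_upper:
  assumes "M \<noteq> {}" "c > 0"
    and upper: "\<And>y. y \<in> M \<Longrightarrow> mdist m' (\<psi> x) (\<psi> y) \<le> c * mdist m x y"
  shows "dist_to_set m' (\<psi> x) (\<psi> ` M) \<le> c * dist_to_set m x M"
proof -
  \<comment> \<open>With \<open>c\<close> moved to the left, the right-hand side is a bare infimum,
    so it suffices to bound each \<open>mdist m x y\<close> from below.\<close>
  have "dist_to_set m' (\<psi> x) (\<psi> ` M) / c \<le> dist_to_set m x M"
  proof (rule dist_to_set_greatest)
    fix y assume y: "y \<in> M"
    have "dist_to_set m' (\<psi> x) (\<psi> ` M) \<le> c * mdist m x y"
      using dist_to_set_le[of "\<psi> y" "\<psi> ` M" m' "\<psi> x"] upper[OF y] y by simp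
    with \<open>c > 0\<close> show "dist_to_set m' (\<psi> x) (\<psi> ` M) / c \<le> mdist m x y"
      by (simp add: field_simps)
  qed (use assms in simp)
  with \<open>c > 0\<close> show ?thesis by (simp add: field_simps)
qed

section \<open>Omega-limits and stable sets\<close>

lemma limitin_bi_lipschitz_cancel:
  assumes "bi_lipschitz m m' \<psi>" "z \<in> mspace m" "\<And>n. f n \<in> mspace m"
    and lim: "limitin (mtopology_of m') (\<lambda>n. \<psi> (f n)) (\<psi> z) F"
  shows "limitin (mtopology_of m) f z F"
proof -
  obtain b c where "b > 0"
    and lower: "\<And>x y. x \<in> mspace m \<Longrightarrow> y \<in> mspace m \<Longrightarrow> b * mdist m x y \<le> mdist m' (\<psi> x) (\<psi> y)"
    using assms(1) by (rule bi_lipschitzE) blast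
  have "((\<lambda>n. mdist m' (\<psi> (f n)) (\<psi> z)) \<longlongrightarrow> 0) F"
    using lim unfolding mtopology_of_def
    by (simp add: Metric_space.limitin_metric_dist_null[OF Metric_space_mspace_mdist])
  then have "((\<lambda>n. mdist m' (\<psi> (f n)) (\<psi> z) / b) \<longlongrightarrow> 0) F"
    using tendsto_divide_zero by blast
  \<comment> \<open>The lower Lipschitz constant brings convergence back from the images to the
    original points.\<close>
  moreover have "mdist m (f n) z \<le> mdist m' (\<psi> (f n)) (\<psi> z) / b" for n
    using lower[of "f n" z] assms(2,3) \<open>b > 0\<close> by (simp add: field_simps)
  ultimately have "((\<lambda>n. mdist m (f n) z) \<longlongrightarrow> 0) F"
    by (intro Lim_null_comparison[of "\<lambda>n. mdist m (f n) z"]) simp_all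
  then show ?thesis
    unfolding mtopology_of_def
    using assms(2,3) by (simp add: Metric_space.limitin_metric_dist_null[OF Metric_space_mspace_mdist])
qed

text \<open>A limit point of the image orbit is pulled back through the surjective
  \<open>\<psi>\<close>. Cancelling \<open>\<psi>\<close> makes its preimage a limit point of the
  original orbit along the same times, so the preimage lies in \<open>M\<close>.\<close>

lemma stable_set_bi_lipschitz:
  assumes bij: "bij_betw \<psi> (mspace m) (mspace m')" and lip: "bi_lipschitz m m' \<psi>"
    and \<phi>: "\<And>t x. t \<in> T \<Longrightarrow> x \<in> mspace m \<Longrightarrow> \<phi> t x \<in> mspace m"
    and conj: "\<And>t x. t \<in> T \<Longrightarrow> x \<in> mspace m \<Longrightarrow> \<phi>' t (\<psi> x) = \<psi> (\<phi> t x)"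
    and x: "x \<in> stable_set T m \<phi> M"
  shows "\<psi> x \<in> stable_set T m' \<phi>' (\<psi> ` M)"
proof -
  have xm: "x \<in> mspace m" and omega: "omega_limit T m \<phi> x \<subseteq> M"
    using x by (auto simp: stable_set_def)
  have "y \<in> \<psi> ` M" if "y \<in> omega_limit T m' \<phi>' (\<psi> x)" for y
  proof -
    obtain \<tau> :: "nat \<Rightarrow> real" where \<tau>: "range \<tau> \<subseteq> T" "filterlim \<tau> at_top sequentially"
      and lim: "limitin (mtopology_of m') (\<lambda>n. \<phi>' (\<tau> n) (\<psi> x)) y sequentially"
      using \<open>y \<in> omega_limit T m' \<phi>' (\<psi> x)\<close> unfolding omega_limit_def by blast
    have \<tau>T: "\<tau> n \<in> T" for n
      using \<tau>(1) by auto
    \<comment> \<open>\<open>limitin\<close> includes membership of the limit in the space, which is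
      what provides the preimage \<open>z\<close>.\<close>
    have "y \<in> mspace m'"
      using limitin_topspace[OF lim] by simp
    then obtain z where z: "z \<in> mspace m" "y = \<psi> z"
      using bij_betw_imp_surj_on[OF bij] by blast
    have "limitin (mtopology_of m) (\<lambda>n. \<phi> (\<tau> n) x) z sequentially"
      using lim unfolding conj[OF \<tau>T xm] z(2)
      by (rule limitin_bi_lipschitz_cancel[OF lip z(1) \<phi>[OF \<tau>T xm]])
    then have "z \<in> omega_limit T m \<phi> x"
      using \<tau> unfolding omega_limit_def by blast
    then show ?thesis
      using omega z(2) by blast
  qed
  moreover have "\<psi> x \<in> mspace m'"
    using bij xm by (rule bij_betw_apply)
  ultimately show ?thesis by (auto simp: stable_set_def)
qed

section \<open>Exponents and spectra\<close>

lemma eventually_time_at_top: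
  "eventually (\<lambda>t. t \<in> T) (time_at_top T)" "eventually (\<lambda>t. t > 0) (time_at_top T)"
proof -
  show "eventually (\<lambda>t. t \<in> T) (time_at_top T)"
    by (simp add: time_at_top_def eventually_inf_principal)
  show "eventually (\<lambda>t. t > 0) (time_at_top T)"
    using eventually_gt_at_top[of "0::real"]
    unfolding time_at_top_def eventually_inf_principal by (rule eventually_mono) simp
qed

text \<open>The difference of the logarithms lies between \<open>ln b\<close> and
  \<open>ln c\<close>; the sum of absolute values covers both ends whatever their signs.\<close>

lemma abs_ln_diff_le:
  fixes b c D D' :: real
  assumes "b > 0" "c > 0" "D > 0" "b * D \<le> D'" "D' \<le> c * D"
  shows "\<bar>ln D' - ln D\<bar> \<le> \<bar>ln b\<bar> + \<bar>ln c\<bar>"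
proof -
  have "D' > 0"
    using assms by (meson less_le_trans mult_pos_pos)
  then have "ln (b * D) \<le> ln D'" "ln D' \<le> ln (c * D)"
    using assms by simp_all
  then show ?thesis
    using assms by (simp add: ln_mult)
qed

text \<open>The second flow is tied to the first only by the conjugacy relation on
  \<open>mspace m\<close>. This form serves \<open>\<psi>\<close>, its inverse and the identity
  alike.\<close>

lemma metric_exponent_bi_lipschitz:
  assumes bij: "bij_betw \<psi> (mspace m) (mspace m')" and lip: "bi_lipschitz m m' \<psi>"
    and M: "M \<subseteq> mspace m"
    and \<phi>: "\<And>t x. t \<in> T \<Longrightarrow> x \<in> mspace m \<Longrightarrow> \<phi> t x \<in> mspace m"
    and conj: "\<And>t x. t \<in> T \<Longrightarrow> x \<in> mspace m \<Longrightarrow> \<phi>' t (\<psi> x) = \<psi> (\<phi> t x)"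
    and reg: "metric_regular T m \<phi> M x"
  shows "metric_regular T m' \<phi>' (\<psi> ` M) (\<psi> x) \<and>
    metric_exponent T m' \<phi>' (\<psi> ` M) (\<psi> x) = metric_exponent T m \<phi> M x"
proof -
  let ?F = "time_at_top T"
  let ?D = "\<lambda>t. dist_to_set m (\<phi> t x) M"
  let ?D' = "\<lambda>t. dist_to_set m' (\<phi>' t (\<psi> x)) (\<psi> ` M)"
  let ?R = "log_rate T m \<phi> M x"
  let ?R' = "log_rate T m' \<phi>' (\<psi> ` M) (\<psi> x)"
  have st: "x \<in> stable_set T m \<phi> M" and pos: "\<forall>\<^sub>F t in ?F. 0 < ?D t"
    using reg by (auto simp: metric_regular_def)
  then have xm: "x \<in> mspace m"
    by (simp add: stable_set_def)
  have "(\<forall>\<^sub>F t in ?F. 0 < ?D' t) \<and> ((\<lambda>t. ?R' t - ?R t) \<longlongrightarrow> 0) ?F"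
  proof (cases "M = {}")
    \<comment> \<open>The infimum of the empty set of reals is the same unspecified number for all metrics.\<close>
    case True
    then have "?D' = ?D"
      using dist_to_set_empty by fastforce
    then have "?R' = ?R"
      by (auto simp: log_rate_def fun_eq_iff dest: fun_cong)
    with \<open>?D' = ?D\<close> pos show ?thesis by (simp add: fun_eq_iff)
  next
    case False
    obtain b c where bc: "b > 0" "c > 0"
      and lower: "\<And>x y. x \<in> mspace m \<Longrightarrow> y \<in> mspace m \<Longrightarrow> b * mdist m x y \<le> mdist m' (\<psi> x) (\<psi> y)"
      and upper: "\<And>x y. x \<in> mspace m \<Longrightarrow> y \<in> mspace m \<Longrightarrow> mdist m' (\<psi> x) (\<psi> y) \<le> c * mdist m x y"
      using lip by (rule bi_lipschitzE) blast
    have bounds: "b * ?D t \<le> ?D' t" "?D' t \<le> c * ?D t" if "t \<in> T" for t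
      using dist_to_set_image_lower[OF False bc(1), of m "\<phi> t x" m' \<psi>]
        dist_to_set_image_upper[OF False bc(2), of m' \<psi> "\<phi> t x" m]
        lower[OF \<phi>[OF that xm]] upper[OF \<phi>[OF that xm]] M by (auto simp: conj[OF that xm])
    have "\<forall>\<^sub>F t in ?F. 0 < ?D' t"
      using pos eventually_time_at_top(1)
    proof eventually_elim
      case (elim t)
      then have "0 < b * ?D t"
        using bc by simp
      with bounds(1)[OF elim(2)] show ?case by linarith
    qed
    moreover have "((\<lambda>t. ?R' t - ?R t) \<longlongrightarrow> 0) ?F"
    proof (rule Lim_null_comparison)
      show "\<forall>\<^sub>F t in ?F. norm (?R' t - ?R t) \<le> (\<bar>ln b\<bar> + \<bar>ln c\<bar>) / t"
        using pos eventually_time_at_top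
      proof eventually_elim
        case (elim t)
        have "?R' t - ?R t = (ln (?D' t) - ln (?D t)) / t"
          by (simp add: log_rate_def diff_divide_distrib)
        with abs_ln_diff_le[OF bc elim(1) bounds[OF elim(2)]] elim(3) show ?case
          by (simp add: divide_right_mono)
      qed
      show "((\<lambda>t. (\<bar>ln b\<bar> + \<bar>ln c\<bar>) / t) \<longlongrightarrow> 0) ?F"
        \<comment> \<open>A limit along all reals restricts to the times in \<open>T\<close>, which
          treats discrete and continuous time together.\<close>
        unfolding time_at_top_def
        by (rule tendsto_mono[OF inf_le1])
          (intro tendsto_divide_0[OF tendsto_const] filterlim_at_top_imp_at_infinity filterlim_ident)
    qed
    ultimately show ?thesis by blast
  qed
  then have pos': "\<forall>\<^sub>F t in ?F. 0 < ?D' t" and diff: "((\<lambda>t. ?R' t - ?R t) \<longlongrightarrow> 0) ?F"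
    by auto
  \<comment> \<open>\<open>Lim\<close> is a definite description of the limit, so this equivalence
    for every \<open>l\<close> transfers both the existence of the limit and its value.\<close>
  have "(?R' \<longlongrightarrow> l) ?F \<longleftrightarrow> (?R \<longlongrightarrow> l) ?F" for l
    using Lim_transform[OF _ diff, of l] Lim_transform2[OF _ diff, of l] by blast
  moreover have "\<psi> x \<in> stable_set T m' \<phi>' (\<psi> ` M)"
    using bij lip \<phi> conj st by (rule stable_set_bi_lipschitz)
  ultimately show ?thesis
    using reg pos'
    by (simp add: metric_regular_def metric_exponent_def Topological_Spaces.Lim_def)
qed

lemma metric_spectrum_bi_lipschitz_subset:
  assumes "bij_betw \<psi> (mspace m) (mspace m')" "bi_lipschitz m m' \<psi>" "M \<subseteq> mspace m"
    and "\<And>t x. t \<in> T \<Longrightarrow> x \<in> mspace m \<Longrightarrow> \<phi> t x \<in> mspace m"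
    and "\<And>t x. t \<in> T \<Longrightarrow> x \<in> mspace m \<Longrightarrow> \<phi>' t (\<psi> x) = \<psi> (\<phi> t x)"
  shows "metric_spectrum T m \<phi> M \<subseteq> metric_spectrum T m' \<phi>' (\<psi> ` M)"
proof
  fix l assume "l \<in> metric_spectrum T m \<phi> M"
  then obtain x where x: "metric_regular T m \<phi> M x" "l = metric_exponent T m \<phi> M x"
    unfolding metric_spectrum_def by blast
  have "metric_regular T m' \<phi>' (\<psi> ` M) (\<psi> x) \<and>
    metric_exponent T m' \<phi>' (\<psi> ` M) (\<psi> x) = metric_exponent T m \<phi> M x"
    using assms x(1) by (rule metric_exponent_bi_lipschitz)
  then show "l \<in> metric_spectrum T m' \<phi>' (\<psi> ` M)"
    unfolding metric_spectrum_def x(2) mem_Collect_eq by (metis (no_types))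
qed

lemma metric_spectrum_bi_lipschitz:
  assumes bij: "bij_betw \<psi> (mspace m) (mspace m')" and lip: "bi_lipschitz m m' \<psi>"
    and M: "M \<subseteq> mspace m"
    and \<phi>: "\<And>t x. t \<in> T \<Longrightarrow> x \<in> mspace m \<Longrightarrow> \<phi> t x \<in> mspace m"
    and conj: "\<And>t x. t \<in> T \<Longrightarrow> x \<in> mspace m \<Longrightarrow> \<phi>' t (\<psi> x) = \<psi> (\<phi> t x)"
  shows "metric_spectrum T m \<phi> M = metric_spectrum T m' \<phi>' (\<psi> ` M)"
proof
  show "metric_spectrum T m \<phi> M \<subseteq> metric_spectrum T m' \<phi>' (\<psi> ` M)"
    using assms by (rule metric_spectrum_bi_lipschitz_subset)
  let ?g = "inv_into (mspace m) \<psi>"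
  have inj: "inj_on \<psi> (mspace m)" and surj: "\<psi> ` mspace m = mspace m'"
    using bij by (auto simp: bij_betw_def)
  \<comment> \<open>The reverse inclusion is the same lemma for the inverse map, which conjugates
    \<open>\<phi>'\<close> back to \<open>\<phi>\<close>.\<close>
  have "metric_spectrum T m' \<phi>' (\<psi> ` M) \<subseteq> metric_spectrum T m \<phi> (?g ` \<psi> ` M)"
  proof (rule metric_spectrum_bi_lipschitz_subset)
    show "bij_betw ?g (mspace m') (mspace m)"
      using bij by (rule bij_betw_inv_into)
    show "bi_lipschitz m' m ?g"
      using lip bij by (rule bi_lipschitz_inv_into)
    show "\<psi> ` M \<subseteq> mspace m'"
      using M surj by blast
    fix t y assume ty: "t \<in> T" "y \<in> mspace m'"
    then obtain x where x: "x \<in> mspace m" "y = \<psi> x"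
      using surj by blast
    \<comment> \<open>Since \<open>y = \<psi> x\<close>, the conjugacy gives
      \<open>\<phi>' t y = \<psi> (\<phi> t x)\<close>. Hence \<open>\<phi>'\<close> stays in the
      space, and applying \<open>?g\<close> returns \<open>\<phi> t x\<close>.\<close>
    show "\<phi>' t y \<in> mspace m'" "\<phi> t (?g y) = ?g (\<phi>' t y)"
      using x \<phi>[OF ty(1) x(1)] conj[OF ty(1) x(1)] surj inj by auto
  qed
  also have "?g ` \<psi> ` M = M"
    using inj M by (rule inv_into_image_cancel)
  finally show "metric_spectrum T m' \<phi>' (\<psi> ` M) \<subseteq> metric_spectrum T m \<phi> M" .
qed

text \<open>That orbits stay in the space is hidden in the continuity clause of
  \<open>flow_on\<close>: \<open>continuous_map\<close> includes mapping the source space into the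
  target space.\<close>

lemma flow_on_in_mspace:
  assumes "flow_on T m \<phi>" "t \<in> T" "x \<in> mspace m"
  shows "\<phi> t x \<in> mspace m"
proof -
  have "continuous_map (prod_topology (top_of_set T) (mtopology_of m)) (mtopology_of m)
      (\<lambda>(t, x). \<phi> t x)"
    using assms(1) by (simp add: flow_on_def)
  from continuous_map_funspace[OF this] have "(\<lambda>(t, x). \<phi> t x) \<in> T \<times> mspace m \<rightarrow> mspace m"
    by simp
  with assms(2,3) show ?thesis by (force dest: Pi_mem[where x = "(t, x)"])
qed

theorem proposition3p1:
  fixes T :: "real set"
    and m :: "'a metric" and mbar :: "'b metric"
    and \<phi> :: "real \<Rightarrow> 'a \<Rightarrow> 'a"
    and M :: "'a set"
    and \<psi> :: "'a \<Rightarrow> 'b"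
  assumes "compact_space (mtopology_of m)"
    and "flow_on T m \<phi>"
    and "compactin (mtopology_of m) M"
    and "isolated_invariant T m \<phi> M"
    and "\<not> is_repeller T m \<phi> M"
    and "bij_betw \<psi> (mspace m) (mspace mbar)"
    and "bi_lipschitz m mbar \<psi>"
  shows "(\<forall>x. metric_regular T m \<phi> M x \<longrightarrow>
             metric_regular T mbar (conjugate_flow m \<psi> \<phi>) (\<psi> ` M) (\<psi> x) \<and>
             metric_exponent T m \<phi> M x =
               metric_exponent T mbar (conjugate_flow m \<psi> \<phi>) (\<psi> ` M) (\<psi> x)) \<and>
         metric_spectrum T m \<phi> M =
           metric_spectrum T mbar (conjugate_flow m \<psi> \<phi>) (\<psi> ` M) \<and>
         (\<forall>m'. equivalent_metrics m m' \<longrightarrow>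
             metric_spectrum T m \<phi> M = metric_spectrum T m' \<phi> M)"
proof -
  have M: "M \<subseteq> mspace m"
    using compactin_subset_topspace[OF assms(3)] by simp
  note \<phi> = flow_on_in_mspace[OF assms(2)]
  have conj: "conjugate_flow m \<psi> \<phi> t (\<psi> x) = \<psi> (\<phi> t x)" if "t \<in> T" "x \<in> mspace m" for t x
    using that bij_betw_inv_into_left[OF assms(6)] by (simp add: conjugate_flow_def)
  \<comment> \<open>For \<open>\<psi> = id\<close> the conjugate of \<open>\<phi>\<close> is
    \<open>\<phi>\<close> itself and the image of \<open>M\<close> is \<open>M\<close>; only the
    metric changes.\<close>
  have "metric_spectrum T m \<phi> M = metric_spectrum T m' \<phi> M" if "equivalent_metrics m m'" for m'
    using metric_spectrum_bi_lipschitz[of id m m' M T \<phi> \<phi>] that \<phi> M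
    by (simp add: equivalent_metrics_def)
  moreover have "metric_regular T mbar (conjugate_flow m \<psi> \<phi>) (\<psi> ` M) (\<psi> x) \<and>
      metric_exponent T mbar (conjugate_flow m \<psi> \<phi>) (\<psi> ` M) (\<psi> x) = metric_exponent T m \<phi> M x"
    if "metric_regular T m \<phi> M x" for x
    using assms(6,7) M \<phi> conj that by (rule metric_exponent_bi_lipschitz)
  moreover have "metric_spectrum T m \<phi> M =
      metric_spectrum T mbar (conjugate_flow m \<psi> \<phi>) (\<psi> ` M)"
    using assms(6,7) M \<phi> conj by (rule metric_spectrum_bi_lipschitz)
  ultimately show ?thesis by simp
qed

end
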